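(* Let $n\ge2$, let $\mathbb F$ be an algebraically closed field of characteristic not $2$, let $V=\mathbb F^n$ with basis $e_1,\dots,e_n$ and dual basis $f_1,\dots,f_n$ of $V^*$. Put $$x_1=e_1-e_2,\quad h_1=f_1+f_2,\qquad x_i=e_{i-1}+e_i,\quad h_i=f_{i-1}-f_i\quad(1<i\le n).$$ Then the linear transformations $x_i\otimes h_i\colon V\to V$, $v\mapsto h_i(v)x_i$ ($1\le i\le n$), realize the graph $\Gamma_{A;n}$ with vertices $1,\dots,n$ and edges $\{i,i+1\}$ ($1\le i\le n-1$) together with $\{1,3\}$ (the latter only when $n\ge3$). Moreover, the Lie algebra $\langle x_i\otimes h_i\mid 1\le i\le n\rangle_{\mathrm{Lie}}$ they generate is $\mathfrak{sl}_n=\mathfrak{sl}(V)$.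
   Context: A nonzero element $x$ of a Lie algebra $\mathcal L$ over $\mathbb F$ is extremal if $[x,[x,\mathcal L]]\subseteq\mathbb Fx$. Elements $y_1,\dots,y_n$ of a Lie algebra realize a graph $\Gamma$ on $\{1,\dots,n\}$ if each $y_i$ is an extremal element of the Lie algebra generated by $y_1,\dots,y_n$ and, for $i\ne j$, vertices $i,j$ are adjacent if and only if $[y_i,y_j]\ne0$. The Lie bracket on endomorphisms is the commutator; $\mathfrak{sl}(V)$ consists of the trace-zero endomorphisms. *)

theory Defs
  imports
    "HOL-Analysis.Analysis"
    "HOL-Computational_Algebra.Polynomial"
    "HOL-Library.Function_Algebras"
begin

section \<open>Lie algebras, extremal elements, realizations of graphs\<close>

text \<open>
  A Lie algebra is given by a carrier \<^term>\<open>L\<close> inside a vector space. The carrier is needed because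
  the bracket used below, the commutator, is bilinear on linear maps but not on arbitrary functions.
\<close>

locale lie_algebra = vector_space scale
  for scale :: "'a::field \<Rightarrow> 'b::ab_group_add \<Rightarrow> 'b" (infixr \<open>\<odot>\<close> 75) +
  fixes L :: "'b set" and bracket :: "'b \<Rightarrow> 'b \<Rightarrow> 'b"
  assumes subspace_carrier: "subspace L"
    and bracket_closed: "x \<in> L \<Longrightarrow> y \<in> L \<Longrightarrow> bracket x y \<in> L"
    and bracket_add_left: "x \<in> L \<Longrightarrow> y \<in> L \<Longrightarrow> z \<in> L \<Longrightarrow> bracket (x + y) z = bracket x z + bracket y z"
    and bracket_add_right: "x \<in> L \<Longrightarrow> y \<in> L \<Longrightarrow> z \<in> L \<Longrightarrow> bracket x (y + z) = bracket x y + bracket x z"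
    and bracket_scale_left: "x \<in> L \<Longrightarrow> y \<in> L \<Longrightarrow> bracket (c \<odot> x) y = c \<odot> bracket x y"
    and bracket_scale_right: "x \<in> L \<Longrightarrow> y \<in> L \<Longrightarrow> bracket x (c \<odot> y) = c \<odot> bracket x y"
    and bracket_self: "x \<in> L \<Longrightarrow> bracket x x = 0"
    and jacobi: "x \<in> L \<Longrightarrow> y \<in> L \<Longrightarrow> z \<in> L \<Longrightarrow>
      bracket x (bracket y z) + bracket y (bracket z x) + bracket z (bracket x y) = 0"
begin

definition lie_subalgebra :: "'b set \<Rightarrow> bool" where
  "lie_subalgebra M \<longleftrightarrow> subspace M \<and> M \<subseteq> L \<and> (\<forall>x\<in>M. \<forall>y\<in>M. bracket x y \<in> M)"

lemma lie_subalgebra_carrier: "lie_subalgebra L"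
  by (simp add: lie_subalgebra_def subspace_carrier bracket_closed)

lemma lie_algebra_lie_subalgebra: "lie_subalgebra M \<Longrightarrow> lie_algebra scale M bracket"
  unfolding lie_subalgebra_def
  by unfold_locales
    (auto simp: subset_iff bracket_add_left bracket_add_right bracket_scale_left
      bracket_scale_right bracket_self jacobi)

text \<open>Meaningful for \<^prop>\<open>S \<subseteq> L\<close> only; otherwise the intersection in \<open>hull\<close> is over no set.\<close>

definition lie_generated :: "'b set \<Rightarrow> 'b set" where
  "lie_generated S = lie_subalgebra hull S"

lemma lie_subalgebra_lie_generated:
  assumes "S \<subseteq> L"
  shows "lie_subalgebra (lie_generated S)"
proof -
  have "lie_generated S \<subseteq> L"
    unfolding lie_generated_def using assms lie_subalgebra_carrier by (auto simp: hull_def)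
  moreover have "subspace (lie_generated S)"
    unfolding lie_generated_def hull_def by (auto simp: lie_subalgebra_def intro!: subspace_Inter)
  moreover have "bracket x y \<in> lie_generated S"
    if "x \<in> lie_generated S" "y \<in> lie_generated S" for x y
    using that unfolding lie_generated_def hull_def by (auto simp: lie_subalgebra_def)
  ultimately show ?thesis
    by (simp add: lie_subalgebra_def)
qed

text \<open>\<^term>\<open>x\<close> is an extremal element of the subalgebra \<^term>\<open>M\<close>, regarded as a Lie algebra on its own.\<close>

definition extremal_in :: "'b set \<Rightarrow> 'b \<Rightarrow> bool" where
  "extremal_in M x \<longleftrightarrow> x \<in> M \<and> x \<noteq> 0 \<and> (\<forall>z\<in>M. \<exists>c. bracket x (bracket x z) = c \<odot> x)"

text \<open>A graph on the vertices \<open>1, \<dots>, n\<close> is given by its set \<^term>\<open>E\<close> of edges, as two-element sets.\<close>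

definition realizes :: "nat \<Rightarrow> nat set set \<Rightarrow> (nat \<Rightarrow> 'b) \<Rightarrow> bool" where
  "realizes n E y \<longleftrightarrow>
     (\<forall>i\<in>{1..n}. y i \<in> L) \<and>
     (\<forall>i\<in>{1..n}. extremal_in (lie_generated (y ` {1..n})) (y i)) \<and>
     (\<forall>i\<in>{1..n}. \<forall>j\<in>{1..n}. i \<noteq> j \<longrightarrow> ({i, j} \<in> E \<longleftrightarrow> bracket (y i) (y j) \<noteq> 0))"

end


section \<open>The Lie algebra of endomorphisms\<close>

definition endomorphisms :: "('a::field ^ 'n \<Rightarrow> 'a ^ 'n) set" where
  "endomorphisms = {T. Vector_Spaces.linear (*s) (*s) T}"

definition scale_fun :: "'a::field \<Rightarrow> ('a ^ 'n \<Rightarrow> 'a ^ 'n) \<Rightarrow> 'a ^ 'n \<Rightarrow> 'a ^ 'n" where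
  "scale_fun c T = (\<lambda>v. c *s T v)"

definition commutator :: "('a::field ^ 'n \<Rightarrow> 'a ^ 'n) \<Rightarrow> ('a ^ 'n \<Rightarrow> 'a ^ 'n) \<Rightarrow> 'a ^ 'n \<Rightarrow> 'a ^ 'n" where
  "commutator S T = (S \<circ> T) - (T \<circ> S)"

lemma mem_endomorphisms_iff:
  "T \<in> endomorphisms \<longleftrightarrow> (\<forall>u v. T (u + v) = T u + T v) \<and> (\<forall>c v. T (c *s v) = c *s T v)"
  by (auto simp: endomorphisms_def Vector_Spaces.linear_iff vec.vector_space_axioms)

lemma endomorphism_add: "T \<in> endomorphisms \<Longrightarrow> T (u + v) = T u + T v"
  by (simp add: mem_endomorphisms_iff)

lemma endomorphism_scale: "T \<in> endomorphisms \<Longrightarrow> T (c *s v) = c *s T v"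
  by (simp add: mem_endomorphisms_iff)

lemma endomorphism_diff: "T \<in> endomorphisms \<Longrightarrow> T (u - v) = T u - T v"
  unfolding endomorphisms_def by (simp add: vec.linear_diff)

lemma endomorphism_zero: "T \<in> endomorphisms \<Longrightarrow> T 0 = 0"
  using endomorphism_diff[of T 0 0] by simp

lemma commutator_apply: "commutator S T v = S (T v) - T (S v)"
  by (simp add: commutator_def)

lemma vector_space_scale_fun: "vector_space scale_fun"
  by unfold_locales
    (simp_all add: scale_fun_def fun_eq_iff vec.scale_right_distrib vec.scale_left_distrib)

interpretation endo: lie_algebra scale_fun endomorphisms commutator
proof -
  interpret vector_space scale_fun
    by (rule vector_space_scale_fun)
  note linear_simps = endomorphism_add endomorphism_scale endomorphism_diff endomorphism_zero
  show "lie_algebra scale_fun endomorphisms commutator"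
  proof unfold_locales
    show "subspace endomorphisms"
      by (auto simp: subspace_def mem_endomorphisms_iff scale_fun_def
          vec.scale_right_distrib vec.scale_left_commute algebra_simps)
    show "commutator S T \<in> endomorphisms" if "S \<in> endomorphisms" "T \<in> endomorphisms" for S T
      using that unfolding mem_endomorphisms_iff[of "commutator S T"]
      by (simp add: commutator_apply linear_simps vec.scale_right_diff_distrib)
  qed (auto simp: fun_eq_iff commutator_apply scale_fun_def linear_simps vec.scale_right_diff_distrib)
qed

definition sl :: "('a::field ^ 'n \<Rightarrow> 'a ^ 'n) set" where
  "sl = {T \<in> endomorphisms. trace (matrix T) = 0}"

text \<open>The map \<open>x \<otimes> h\<close> for a vector \<open>x\<close> and a linear functional \<open>h\<close>.\<close>

definition rank_one :: "'a::field ^ 'n \<Rightarrow> ('a ^ 'n \<Rightarrow> 'a) \<Rightarrow> 'a ^ 'n \<Rightarrow> 'a ^ 'n" (infix \<open>\<otimes>\<^sub>1\<close> 70) where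
  "x \<otimes>\<^sub>1 h = (\<lambda>v. h v *s x)"


section \<open>Bases, and the realization\<close>

definition is_basis :: "nat \<Rightarrow> (nat \<Rightarrow> 'a::field ^ 'n) \<Rightarrow> bool" where
  "is_basis n e \<longleftrightarrow>
     inj_on e {1..n} \<and> vec.independent (e ` {1..n}) \<and> vec.span (e ` {1..n}) = UNIV"

definition is_dual_basis :: "nat \<Rightarrow> (nat \<Rightarrow> 'a::field ^ 'n) \<Rightarrow> (nat \<Rightarrow> 'a ^ 'n \<Rightarrow> 'a) \<Rightarrow> bool" where
  "is_dual_basis n e f \<longleftrightarrow>
     (\<forall>i\<in>{1..n}. Vector_Spaces.linear (*s) (*) (f i)) \<and>
     (\<forall>i\<in>{1..n}. \<forall>j\<in>{1..n}. f i (e j) = (if i = j then 1 else 0))"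

definition x_vec :: "(nat \<Rightarrow> 'a::field ^ 'n) \<Rightarrow> nat \<Rightarrow> 'a ^ 'n" where
  "x_vec e i = (if i = 1 then e 1 - e 2 else e (i - 1) + e i)"

definition h_form :: "(nat \<Rightarrow> 'a::field ^ 'n \<Rightarrow> 'a) \<Rightarrow> nat \<Rightarrow> 'a ^ 'n \<Rightarrow> 'a" where
  "h_form f i = (if i = 1 then f 1 + f 2 else f (i - 1) - f i)"

definition Gamma_A :: "nat \<Rightarrow> nat set set" where
  "Gamma_A n = {{i, i + 1} |i. 1 \<le> i \<and> i \<le> n - 1} \<union> (if n \<ge> 3 then {{1, 3}} else {})"

end

theory Submission
  imports Defs
begin

text \<open>
  Write \<open>E i j = e i \<otimes>\<^sub>1 f j\<close>. In characteristic not 2, the matrices \<open>E 1 2\<close> and \<open>E 2 1\<close> are linear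
  combinations of the first two generators and their commutator. If all \<open>E i j\<close> with \<open>i \<noteq> j\<close> and
  \<open>i, j \<le> k\<close> are available, then commutators of \<open>E i k\<close> and \<open>E k i\<close> (\<open>i < k\<close>) with generator \<open>k + 1\<close>
  produce \<open>E i (k + 1)\<close> and \<open>E (k + 1) i\<close>, and commutators of these produce the rest for \<open>k + 1\<close>.
  Together with \<open>E i i - E j j = [E i j, E j i]\<close> they span \<open>sl\<close>. Extremality holds as \<open>h x = 0\<close>
  implies \<open>[x \<otimes> h, [x \<otimes> h, T]] = -2 h (T x) (x \<otimes> h)\<close>.
\<close>

section \<open>Linear functionals and rank one maps\<close>

abbreviation linear_form :: "('a::field ^ 'n \<Rightarrow> 'a) \<Rightarrow> bool" where
  "linear_form \<equiv> Vector_Spaces.linear (*s) (*)"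

lemma linear_form_iff:
  "linear_form h \<longleftrightarrow> (\<forall>u v. h (u + v) = h u + h v) \<and> (\<forall>c v. h (c *s v) = c * h v)"
  by (auto simp: Vector_Spaces.linear_iff vec.vector_space_axioms vector_space_def algebra_simps)

lemma linear_form_simps:
  assumes "linear_form h"
  shows "h (u + v) = h u + h v" "h (c *s v) = c * h v" "h (u - v) = h u - h v" "h 0 = 0"
proof -
  show add: "h (u + v) = h u + h v" for u v
    using assms by (simp add: linear_form_iff)
  show "h (c *s v) = c * h v" using assms by (simp add: linear_form_iff)
  show diff: "h (u - v) = h u - h v" for u v using add[of "u - v" v] by simp
  show "h 0 = 0" using diff[of 0 0] by simp
qed

lemma linear_form_sum:
  assumes "linear_form h"
  shows "h (\<Sum>i\<in>A. u i) = (\<Sum>i\<in>A. h (u i))"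
  by (induction A rule: infinite_finite_induct) (simp_all add: linear_form_simps[OF assms])

lemma linear_form_add: "linear_form g \<Longrightarrow> linear_form h \<Longrightarrow> linear_form (g + h)"
  by (simp add: linear_form_iff algebra_simps)

lemma linear_form_diff: "linear_form g \<Longrightarrow> linear_form h \<Longrightarrow> linear_form (g - h)"
  by (simp add: linear_form_iff algebra_simps)

lemma rank_one_apply: "(x \<otimes>\<^sub>1 h) v = h v *s x"
  by (simp add: rank_one_def)

lemma rank_one_in_endomorphisms: "linear_form h \<Longrightarrow> x \<otimes>\<^sub>1 h \<in> endomorphisms"
  by (simp add: mem_endomorphisms_iff rank_one_apply linear_form_simps vec.scale_left_distrib)

lemma commutator_rank_one:
  assumes "linear_form g" "linear_form h"
  shows "commutator (x \<otimes>\<^sub>1 g) (y \<otimes>\<^sub>1 h) = scale_fun (g y) (x \<otimes>\<^sub>1 h) - scale_fun (h x) (y \<otimes>\<^sub>1 g)"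
  using assms
  by (simp add: fun_eq_iff commutator_apply scale_fun_def rank_one_apply linear_form_simps mult.commute)

text \<open>Write \<open>X\<close> for the rank one map. Since \<open>h x = 0\<close>,
  \<open>X\<close> squares to zero, so the double commutator collapses to -2 \<open>X T X\<close>,
  and \<open>X T X\<close> is \<open>h (T x)\<close> times \<open>X\<close>.\<close>

lemma commutator_rank_one_twice:
  assumes T: "T \<in> endomorphisms" and h: "linear_form h" and hx: "h x = 0"
  shows "commutator (x \<otimes>\<^sub>1 h) (commutator (x \<otimes>\<^sub>1 h) T) = scale_fun (- 2 * h (T x)) (x \<otimes>\<^sub>1 h)"
proof
  fix v
  show "commutator (x \<otimes>\<^sub>1 h) (commutator (x \<otimes>\<^sub>1 h) T) v = scale_fun (- 2 * h (T x)) (x \<otimes>\<^sub>1 h) v"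
    by (simp add: commutator_apply scale_fun_def rank_one_apply linear_form_simps[OF h]
        endomorphism_scale[OF T] endomorphism_zero[OF T] hx vec_eq_iff algebra_simps)
qed

text \<open>Evaluating the commutator at \<open>v\<close> and applying \<open>k\<close> gives the
  difference of the two products, so well-chosen test data \<open>v\<close>, \<open>k\<close> reduce
  non-vanishing to comparing two scalars.\<close>

lemma commutator_rank_one_neqI:
  assumes "linear_form g" "linear_form h" "linear_form k"
    and "g y * h v * k x \<noteq> h x * g v * k y"
  shows "commutator (x \<otimes>\<^sub>1 g) (y \<otimes>\<^sub>1 h) \<noteq> 0"
proof
  assume "commutator (x \<otimes>\<^sub>1 g) (y \<otimes>\<^sub>1 h) = 0"
  then have "k (commutator (x \<otimes>\<^sub>1 g) (y \<otimes>\<^sub>1 h) v) = 0"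
    by (simp add: linear_form_simps[OF assms(3)])
  then show False
    using assms by (simp add: commutator_rank_one scale_fun_def rank_one_apply linear_form_simps)
qed

lemma sum_fun_apply: "(\<Sum>j\<in>A. F j) v = (\<Sum>j\<in>A. F j v)"
  by (induction A rule: infinite_finite_induct) simp_all

lemma four_neq_0: "(2 :: 'a::field) \<noteq> 0 \<Longrightarrow> (4 :: 'a) \<noteq> 0"
  by (metis mult_2_right mult_eq_0_iff numeral_Bit0)

lemma commutator_skew: "commutator S T = - commutator T S"
  by (simp add: commutator_def)

text \<open>The i-th diagonal entry is \<open>x $ i * h (axis i 1)\<close>; these entries sum to
  \<open>h\<close> applied to the standard expansion of \<open>x\<close>.\<close>

lemma trace_rank_one:
  fixes x :: "'a::field ^ 'n"
  assumes h: "linear_form h"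
  shows "trace (matrix (x \<otimes>\<^sub>1 h)) = h x"
proof -
  have "h x = h (\<Sum>i\<in>UNIV. x $ i *s axis i 1)"
    by (simp add: basis_expansion)
  also have "\<dots> = trace (matrix (x \<otimes>\<^sub>1 h))"
    by (simp add: linear_form_sum[OF h] linear_form_simps[OF h] trace_def matrix_def rank_one_apply
        mult.commute)
  finally show ?thesis ..
qed

lemma trace_commutator:
  fixes S T :: "'a::field ^ 'n \<Rightarrow> 'a ^ 'n"
  assumes "S \<in> endomorphisms" "T \<in> endomorphisms"
  shows "trace (matrix (commutator S T)) = 0"
proof -
  have "matrix (commutator S T) = matrix (S \<circ> T) - matrix (T \<circ> S)"
    by (simp add: commutator_def matrix_def vec_eq_iff)
  then show ?thesis
    using assms trace_mul_sym[of "matrix S" "matrix T"]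
    by (simp add: endomorphisms_def matrix_compose_gen trace_sub)
qed

lemma lie_subalgebra_sl: "endo.lie_subalgebra (sl :: ('a::field ^ 'n \<Rightarrow> 'a ^ 'n) set)"
proof -
  have add: "matrix (S + T) = matrix S + matrix T"
    and scale: "trace (matrix (scale_fun c T)) = c * trace (matrix T)"
    for c and S T :: "'a ^ 'n \<Rightarrow> 'a ^ 'n"
    by (simp_all add: matrix_def vec_eq_iff scale_fun_def trace_def sum_distrib_left)
  have "trace (matrix (0 :: 'a ^ 'n \<Rightarrow> 'a ^ 'n)) = 0"
    by (simp add: matrix_def trace_def)
  then have "endo.subspace (sl :: ('a ^ 'n \<Rightarrow> 'a ^ 'n) set)"
    using endo.subspace_carrier unfolding endo.subspace_def sl_def
    by (auto simp: add scale trace_add)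
  then show ?thesis
    by (auto simp: endo.lie_subalgebra_def sl_def trace_commutator endo.bracket_closed)
qed


section \<open>Dual bases\<close>

locale dual_bases =
  fixes e :: "nat \<Rightarrow> 'a::field ^ 'n" and f :: "nat \<Rightarrow> 'a ^ 'n \<Rightarrow> 'a" and n :: nat
  assumes basis: "is_basis n e" and dual: "is_dual_basis n e f"
begin

lemma linear_form_f: "i \<in> {1..n} \<Longrightarrow> linear_form (f i)"
  using dual by (simp add: is_dual_basis_def)

lemma f_e: "i \<in> {1..n} \<Longrightarrow> j \<in> {1..n} \<Longrightarrow> f i (e j) = (if i = j then 1 else 0)"
  using dual by (simp add: is_dual_basis_def)

lemma expansion: "v = (\<Sum>i\<in>{1..n}. f i v *s e i)"
proof -
  have "v \<in> vec.span (e ` {1..n})"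
    using basis by (simp add: is_basis_def)
  then obtain c where "v = (\<Sum>b\<in>e ` {1..n}. c b *s b)"
    by (auto simp: vec.span_finite)
  then have v: "v = (\<Sum>j\<in>{1..n}. c (e j) *s e j)"
    using basis by (simp add: is_basis_def sum.reindex)
  \<comment> \<open>By duality, \<open>f i\<close> isolates the i-th coefficient of any combination
    that represents \<open>v\<close>.\<close>
  have "f i v = c (e i)" if i: "i \<in> {1..n}" for i
  proof -
    have "f i v = (\<Sum>j\<in>{1..n}. c (e j) * f i (e j))"
      by (subst v) (simp add: linear_form_f[OF i] linear_form_sum linear_form_simps)
    also have "\<dots> = (\<Sum>j\<in>{1..n}. if i = j then c (e j) else 0)"
      by (rule sum.cong) (use i f_e in auto)
    finally show ?thesis using i by simp
  qed
  then show ?thesis by (subst v) simp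
qed

lemma endomorphism_expansion:
  assumes T: "T \<in> endomorphisms"
  shows "T = (\<Sum>j\<in>{1..n}. T (e j) \<otimes>\<^sub>1 f j)"
proof
  fix v
  have T_sum: "T (\<Sum>j\<in>A. u j) = (\<Sum>j\<in>A. T (u j))" for A and u :: "nat \<Rightarrow> 'a ^ 'n"
    by (induction A rule: infinite_finite_induct)
      (simp_all add: endomorphism_zero[OF T] endomorphism_add[OF T])
  have "T v = T (\<Sum>j\<in>{1..n}. f j v *s e j)"
    using expansion[of v] by simp
  also have "\<dots> = (\<Sum>j\<in>{1..n}. T (e j) \<otimes>\<^sub>1 f j) v"
    by (simp add: sum_fun_apply T_sum endomorphism_scale[OF T] rank_one_apply)
  finally show "T v = (\<Sum>j\<in>{1..n}. T (e j) \<otimes>\<^sub>1 f j) v" .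
qed

text \<open>\<open>matrix\<close> refers to the standard basis, whereas \<open>e\<close> is
  arbitrary. Splitting \<open>T\<close> into rank one maps, whose traces are known, bridges the two
  without a change of basis.\<close>

lemma trace_eq:
  assumes T: "T \<in> endomorphisms"
  shows "trace (matrix T) = (\<Sum>j\<in>{1..n}. f j (T (e j)))"
proof -
  have tr_sum: "trace (matrix (\<Sum>j\<in>A. F j)) = (\<Sum>j\<in>A. trace (matrix (F j)))"
    for A and F :: "nat \<Rightarrow> 'a ^ 'n \<Rightarrow> 'a ^ 'n"
    by (induction A rule: infinite_finite_induct)
      (simp_all add: trace_def matrix_def sum.distrib)
  show ?thesis
    by (subst endomorphism_expansion[OF T]) (simp add: tr_sum trace_rank_one linear_form_f)
qed

lemma sl_subset_lie_subalgebra: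
  assumes M: "endo.lie_subalgebra M"
    and E: "\<And>i j. i \<in> {1..n} \<Longrightarrow> j \<in> {1..n} \<Longrightarrow> i \<noteq> j \<Longrightarrow> e i \<otimes>\<^sub>1 f j \<in> M"
  shows "sl \<subseteq> M"
proof
  fix T :: "'a ^ 'n \<Rightarrow> 'a ^ 'n" assume "T \<in> sl"
  then have T: "T \<in> endomorphisms" and tr: "(\<Sum>j\<in>{1..n}. f j (T (e j))) = 0"
    using trace_eq[of T] by (auto simp: sl_def)
  have sub: "endo.subspace M" and cl: "\<And>S T. S \<in> M \<Longrightarrow> T \<in> M \<Longrightarrow> commutator S T \<in> M"
    using M by (auto simp: endo.lie_subalgebra_def)
  have D: "e j \<otimes>\<^sub>1 f j - e 1 \<otimes>\<^sub>1 f 1 \<in> M" if j: "j \<in> {1..n}" for j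
  proof (cases "j = 1")
    case True
    then show ?thesis using endo.subspace_0[OF sub] by simp
  next
    case False
    have "commutator (e j \<otimes>\<^sub>1 f 1) (e 1 \<otimes>\<^sub>1 f j) = e j \<otimes>\<^sub>1 f j - e 1 \<otimes>\<^sub>1 f 1"
      using j f_e by (simp add: commutator_rank_one linear_form_f scale_fun_def)
    moreover have "commutator (e j \<otimes>\<^sub>1 f 1) (e 1 \<otimes>\<^sub>1 f j) \<in> M"
      using j False by (intro cl E) auto
    ultimately show ?thesis by simp
  qed
  define c where "c i j = f i (T (e j))" for i j
  \<comment> \<open>Replacing each diagonal unit by its difference with
    \<open>e 1 \<otimes>\<^sub>1 f 1\<close> keeps every summand in \<open>M\<close>. In total this
    subtracts the trace of \<open>T\<close> times that unit, which is zero.\<close>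
  define F where "F i j = scale_fun (c i j) (e i \<otimes>\<^sub>1 f j - (if i = j then e 1 \<otimes>\<^sub>1 f 1 else 0))" for i j
  have "F i j \<in> M" if "i \<in> {1..n}" "j \<in> {1..n}" for i j
    using that D E unfolding F_def by (auto intro!: endo.subspace_scale[OF sub])
  then have "(\<Sum>j\<in>{1..n}. \<Sum>i\<in>{1..n}. F i j) \<in> M"
    by (intro endo.subspace_sum[OF sub]) auto
  moreover have "T = (\<Sum>j\<in>{1..n}. \<Sum>i\<in>{1..n}. F i j)"
  proof
    fix v
    have "(\<Sum>j\<in>{1..n}. \<Sum>i\<in>{1..n}. F i j) v
      = (\<Sum>j\<in>{1..n}. \<Sum>i\<in>{1..n}. (f j v * c i j) *s e i - (if i = j then (f 1 v * c j j) *s e 1 else 0))"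
      unfolding sum_fun_apply F_def
      by (intro sum.cong refl)
        (simp add: scale_fun_def rank_one_apply vec.scale_right_diff_distrib mult.commute)
    also have "\<dots> = (\<Sum>j\<in>{1..n}. f j v *s (\<Sum>i\<in>{1..n}. c i j *s e i)) - (f 1 v * (\<Sum>j\<in>{1..n}. c j j)) *s e 1"
      by (simp add: sum_subtractf vec.scale_sum_right vec.scale_sum_left sum_distrib_left)
    also have "\<dots> = (\<Sum>j\<in>{1..n}. f j v *s T (e j))"
      using tr expansion[of "T (e _)"] by (simp add: c_def)
    also have "\<dots> = T v"
      by (subst (2) endomorphism_expansion[OF T]) (simp add: sum_fun_apply rank_one_apply)
    finally show "T v = (\<Sum>j\<in>{1..n}. \<Sum>i\<in>{1..n}. F i j) v" ..
  qed
  ultimately show "T \<in> M" by simp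
qed

section \<open>The generators in coordinates\<close>

lemma linear_form_h: "n \<ge> 2 \<Longrightarrow> i \<in> {1..n} \<Longrightarrow> linear_form (h_form f i)"
  unfolding h_form_def by (auto intro!: linear_form_add linear_form_diff linear_form_f)

lemma h_form_e:
  assumes "n \<ge> 2" "i \<in> {1..n}" "j \<in> {1..n}"
  shows "h_form f i (e j) =
    (if i = 1 then (if j \<le> 2 then 1 else 0) else if j = i - 1 then 1 else if j = i then - 1 else 0)"
  using assms by (cases i) (auto simp: h_form_def f_e Suc_le_eq)

lemma f_x_vec:
  assumes "n \<ge> 2" "i \<in> {1..n}" "j \<in> {1..n}"
  shows "f i (x_vec e j) =
    (if j = 1 then (if i = 1 then 1 else if i = 2 then - 1 else 0)
     else if i = j - 1 \<or> i = j then 1 else 0)"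
  using assms by (cases j) (auto simp: x_vec_def f_e linear_form_f linear_form_simps Suc_le_eq)

lemma h_form_x_vec:
  assumes "n \<ge> 2" "i \<in> {1..n}" "j \<in> {1..n}"
  shows "h_form f i (x_vec e j) =
    (if j = 1 then h_form f i (e 1) - h_form f i (e 2) else h_form f i (e (j - 1)) + h_form f i (e j))"
  using assms by (simp add: x_vec_def linear_form_h linear_form_simps)

text \<open>The two contributions 1 and -1 cancel. This puts the generators in \<open>sl\<close> and
  supplies the hypothesis of \<open>commutator_rank_one_twice\<close>.\<close>

lemma h_form_x_vec_self: "n \<ge> 2 \<Longrightarrow> i \<in> {1..n} \<Longrightarrow> h_form f i (x_vec e i) = 0"
  by (cases i) (auto simp: h_form_x_vec h_form_e Suc_le_eq)

abbreviation gen :: "nat \<Rightarrow> 'a ^ 'n \<Rightarrow> 'a ^ 'n" where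
  "gen i \<equiv> x_vec e i \<otimes>\<^sub>1 h_form f i"

lemma gen_in_endomorphisms: "n \<ge> 2 \<Longrightarrow> i \<in> {1..n} \<Longrightarrow> gen i \<in> endomorphisms"
  by (intro rank_one_in_endomorphisms linear_form_h)

lemma gen_in_sl: "n \<ge> 2 \<Longrightarrow> i \<in> {1..n} \<Longrightarrow> gen i \<in> sl"
  by (simp add: sl_def gen_in_endomorphisms trace_rank_one linear_form_h h_form_x_vec_self
      del: atLeastAtMost_iff)

lemma gen_neq_0:
  assumes n: "n \<ge> 2" and i: "i \<in> {1..n}"
  shows "gen i \<noteq> 0"
proof
  \<comment> \<open>At this index both \<open>x_vec e i\<close> and \<open>h_form f i\<close> have
    coefficient 1.\<close>
  define k where "k = (if i = 1 then 1 else i - 1)"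
  have k: "k \<in> {1..n}" using i by (auto simp: k_def)
  assume "gen i = 0"
  then have "f k (gen i (e k)) = 0"
    using k by (simp add: linear_form_simps linear_form_f)
  moreover have "f k (gen i (e k)) = 1"
    using n i k by (auto simp: rank_one_apply linear_form_simps linear_form_f f_x_vec h_form_e k_def)
  ultimately show False by simp
qed

section \<open>The commutation graph\<close>

lemma commutator_gen_less:
  assumes two: "(2 :: 'a) \<noteq> 0" and n: "n \<ge> 2" and i: "i \<in> {1..n}" and j: "j \<in> {1..n}" and "i < j"
  shows "commutator (gen i) (gen j) \<noteq> 0 \<longleftrightarrow> j = i + 1 \<or> i = 1 \<and> j = 3"
proof -
  note lin = linear_form_h[OF n i] linear_form_h[OF n j]
  note vals = h_form_x_vec[OF n] h_form_e[OF n] f_x_vec[OF n]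
  \<comment> \<open>Generator \<open>i > 1\<close> involves the indices \<open>i - 1\<close> and
    \<open>i\<close>, but generator 1 involves 1 and 2, just as generator 2 does. Hence generator 1
    also meets generator 3.\<close>
  consider "i = 1" "j = 2" | "i = 1" "j = 3" | "i > 1" "j = i + 1" | "\<not> (j = i + 1 \<or> i = 1 \<and> j = 3)"
    using \<open>i < j\<close> i by fastforce
  then show ?thesis
  proof cases
    case 1
    \<comment> \<open>Both mixed pairings equal 2, and the test data give -2 against 2. These differ
      because 4 is nonzero.\<close>
    have "commutator (gen i) (gen j) \<noteq> 0"
      using n 1 lin linear_form_f[of 2]
      by (intro commutator_rank_one_neqI[where v = "e 1" and k = "f 2"])
        (auto simp: vals eq_neg_iff_add_eq_0 neg_eq_iff_add_eq_0 four_neq_0[OF two])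
    with 1 show ?thesis by simp
  next
    case 2
    \<comment> \<open>\<open>h_form f 1\<close> vanishes at \<open>e 3\<close>, which kills the
      second product; the first is -1.\<close>
    then have "commutator (gen i) (gen j) \<noteq> 0"
      using n j lin linear_form_f[of 1]
      by (intro commutator_rank_one_neqI[where v = "e 3" and k = "f 1"]) (auto simp: vals)
    with 2 show ?thesis by simp
  next
    case 3
    then have i1: "i - 1 \<in> {1..n}" using i by auto
    \<comment> \<open>Again \<open>h_form f i\<close> vanishes at \<open>e j\<close>; the first
      product is 1.\<close>
    from 3 have "commutator (gen i) (gen j) \<noteq> 0"
      using n i j i1 lin linear_form_f[OF i1]
      by (intro commutator_rank_one_neqI[where v = "e j" and k = "f (i - 1)"]) (auto simp: vals)
    with 3 show ?thesis by simp
  next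
    case 4
    \<comment> \<open>The two generators involve disjoint sets of indices.\<close>
    then have "h_form f i (x_vec e j) = 0" "h_form f j (x_vec e i) = 0"
      using \<open>i < j\<close> i j n by (cases i; cases j; auto simp: vals Suc_le_eq)+
    then have "commutator (gen i) (gen j) = 0"
      using lin by (simp add: commutator_rank_one scale_fun_def fun_eq_iff)
    with 4 show ?thesis by simp
  qed
qed

lemma Gamma_A_iff:
  assumes "i \<in> {1..n}" "j \<in> {1..n}" "i < j"
  shows "{i, j} \<in> Gamma_A n \<longleftrightarrow> j = i + 1 \<or> i = 1 \<and> j = 3"
  using assms by (auto simp: Gamma_A_def doubleton_eq_iff)

text \<open>Edges are unordered and the commutator is skew, so the case \<open>i < j\<close>
  suffices.\<close>

lemma Gamma_A_gen:
  assumes two: "(2 :: 'a) \<noteq> 0" and n: "n \<ge> 2" and i: "i \<in> {1..n}" and j: "j \<in> {1..n}" and "i \<noteq> j"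
  shows "{i, j} \<in> Gamma_A n \<longleftrightarrow> commutator (gen i) (gen j) \<noteq> 0"
proof (cases "i < j")
  case True
  then show ?thesis
    using commutator_gen_less[OF two n i j] Gamma_A_iff[OF i j] by simp
next
  case False
  then have "j < i" using \<open>i \<noteq> j\<close> by simp
  then show ?thesis
    using commutator_gen_less[OF two n j i] Gamma_A_iff[OF j i]
    by (simp add: insert_commute commutator_skew[of "gen i"])
qed

section \<open>Generating \<open>sl\<close> from matrix units\<close>

lemma matrix_units_in_lie_subalgebra:
  assumes two: "(2 :: 'a) \<noteq> 0" and M: "endo.lie_subalgebra M"
    and gen: "\<And>i. i \<in> {1..n} \<Longrightarrow> gen i \<in> M"
    and "2 \<le> k" "k \<le> n" "i \<in> {1..k}" "j \<in> {1..k}" "i \<noteq> j"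
  shows "e i \<otimes>\<^sub>1 f j \<in> M"
proof -
  have sub: "endo.subspace M" and cl: "\<And>S T. S \<in> M \<Longrightarrow> T \<in> M \<Longrightarrow> commutator S T \<in> M"
    using M by (auto simp: endo.lie_subalgebra_def)
  show ?thesis
    using assms(4-)
  proof (induction k arbitrary: i j rule: dec_induct)
    case base
    have f: "linear_form (f 1)" "linear_form (f 2)"
      using base linear_form_f by auto
    have f_e': "f 1 (e 1) = 1" "f 1 (e 2) = 0" "f 2 (e 1) = 0" "f 2 (e 2) = 1"
      using base f_e by auto
    have g: "gen 1 \<in> M" "gen 2 \<in> M"
      using base gen by auto
    have gens: "gen 1 = (e 1 - e 2) \<otimes>\<^sub>1 (f 1 + f 2)" "gen 2 = (e 1 + e 2) \<otimes>\<^sub>1 (f 1 - f 2)"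
      by (simp_all add: x_vec_def h_form_def)
    \<comment> \<open>Both mixed pairings are 2, so the commutator is twice
      \<open>(e 1 - e 2) \<otimes>\<^sub>1 (f 1 - f 2)\<close> minus
      \<open>(e 1 + e 2) \<otimes>\<^sub>1 (f 1 + f 2)\<close>; the diagonal parts cancel and the
      off-diagonal ones add up.\<close>
    have "commutator (gen 1) (gen 2) = scale_fun (- 4) (e 1 \<otimes>\<^sub>1 f 2 + e 2 \<otimes>\<^sub>1 f 1)"
      unfolding gens commutator_rank_one[OF linear_form_add[OF f] linear_form_diff[OF f]]
      by (simp add: fun_eq_iff scale_fun_def rank_one_apply linear_form_simps[OF f(1)]
          linear_form_simps[OF f(2)] f_e' vec_eq_iff algebra_simps del: One_nat_def)
    then have sum: "scale_fun (- 4) (e 1 \<otimes>\<^sub>1 f 2 + e 2 \<otimes>\<^sub>1 f 1) \<in> M"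
      using cl[OF g] by simp
    \<comment> \<open>Both generators have the same diagonal part and opposite off-diagonal
      parts.\<close>
    have "gen 1 - gen 2 = scale_fun 2 (e 1 \<otimes>\<^sub>1 f 2 - e 2 \<otimes>\<^sub>1 f 1)"
      unfolding gens
      by (simp add: fun_eq_iff scale_fun_def rank_one_apply vec_eq_iff algebra_simps)
    then have diff: "scale_fun 2 (e 1 \<otimes>\<^sub>1 f 2 - e 2 \<otimes>\<^sub>1 f 1) \<in> M"
      using endo.subspace_diff[OF sub g] by simp
    have 1: "e 1 \<otimes>\<^sub>1 f 2 + e 2 \<otimes>\<^sub>1 f 1 \<in> M" and 2: "e 1 \<otimes>\<^sub>1 f 2 - e 2 \<otimes>\<^sub>1 f 1 \<in> M"
      using endo.subspace_scale[OF sub sum, of "- inverse 4"]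
        endo.subspace_scale[OF sub diff, of "inverse 2"] two four_neq_0[OF two] by (simp_all add: add.commute)
    have half: "scale_fun (inverse 2) (U + U) = U" for U :: "'a ^ 'n \<Rightarrow> 'a ^ 'n"
    proof -
      have "scale_fun (inverse 2) (U + U) = scale_fun (inverse 2) (scale_fun 2 U)"
        by (simp add: scale_fun_def fun_eq_iff vec_eq_iff)
      then show ?thesis using two by simp
    qed
    have "e 1 \<otimes>\<^sub>1 f 2 \<in> M"
      using endo.subspace_scale[OF sub endo.subspace_add[OF sub 1 2], of "inverse 2"]
        half[of "e 1 \<otimes>\<^sub>1 f 2"] by simp
    moreover have "e 2 \<otimes>\<^sub>1 f 1 \<in> M"
      using endo.subspace_diff[OF sub 1 \<open>e 1 \<otimes>\<^sub>1 f 2 \<in> M\<close>] by simp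
    moreover have "(i, j) = (1, 2) \<or> (i, j) = (2, 1)"
      using base by auto
    ultimately show ?case by auto
  next
    case (step k)
    have k: "k \<in> {1..n}" "Suc k \<in> {1..n}" using step.hyps step.prems by auto
    define g where "g = f k - f (Suc k)"
    define y where "y = e k + e (Suc k)"
    have f: "linear_form (f k)" "linear_form (f (Suc k))" and g: "linear_form g"
      unfolding g_def using k linear_form_f by (auto intro: linear_form_diff)
    have IH: "e a \<otimes>\<^sub>1 f b \<in> M" if "a \<in> {1..k}" "b \<in> {1..k}" "a \<noteq> b" for a b
      using step.IH[of a b] that step.prems by simp
    have X: "y \<otimes>\<^sub>1 g \<in> M"
      using gen[OF k(2)] step.hyps by (simp add: x_vec_def h_form_def y_def g_def)
    \<comment> \<open>The bound \<open>a < k\<close> is strict: the units with indices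
      \<open>a\<close> and \<open>k\<close> must be off-diagonal to come from \<open>IH\<close>, and
      \<open>g (e a)\<close> and \<open>f a y\<close> must vanish so that each commutator is a
      single rank one map.\<close>
    have row: "e a \<otimes>\<^sub>1 f (Suc k) \<in> M" and col: "e (Suc k) \<otimes>\<^sub>1 f a \<in> M"
      if a: "a \<in> {1..<k}" for a
    proof -
      have a': "a \<in> {1..n}" using a step.prems by auto
      note fa = linear_form_f[OF a']
      have z: "f k y = 1" "g (e a) = 0" "f a y = 0" "g (e k) = 1"
        using a k a' by (simp_all add: y_def g_def linear_form_simps[OF f(1)] linear_form_simps[OF fa] f_e)
      have "commutator (e a \<otimes>\<^sub>1 f k) (y \<otimes>\<^sub>1 g) = e a \<otimes>\<^sub>1 g"
        by (simp add: commutator_rank_one[OF f(1) g] z scale_fun_def fun_eq_iff)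
      then have "e a \<otimes>\<^sub>1 g \<in> M"
        using cl[OF IH X, of a k] a by auto
      moreover have "e a \<otimes>\<^sub>1 f (Suc k) = e a \<otimes>\<^sub>1 f k - e a \<otimes>\<^sub>1 g"
        by (simp add: g_def fun_eq_iff rank_one_apply vec.scale_left_diff_distrib)
      ultimately show "e a \<otimes>\<^sub>1 f (Suc k) \<in> M"
        using endo.subspace_diff[OF sub IH, of a k] a by auto
      have "commutator (y \<otimes>\<^sub>1 g) (e k \<otimes>\<^sub>1 f a) = y \<otimes>\<^sub>1 f a"
        by (simp add: commutator_rank_one[OF g fa] z scale_fun_def fun_eq_iff)
      then have "y \<otimes>\<^sub>1 f a \<in> M"
        using cl[OF X IH, of k a] a by auto
      moreover have "e (Suc k) \<otimes>\<^sub>1 f a = y \<otimes>\<^sub>1 f a - e k \<otimes>\<^sub>1 f a"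
        by (simp add: y_def fun_eq_iff rank_one_apply vec.scale_right_distrib)
      ultimately show "e (Suc k) \<otimes>\<^sub>1 f a \<in> M"
        using endo.subspace_diff[OF sub _ IH, of _ k a] a by auto
    qed
    \<comment> \<open>Index 1 serves as the intermediate index linking \<open>k\<close> and
      \<open>Suc k\<close>, the pair left out by \<open>row\<close> and \<open>col\<close>. It lies
      strictly below \<open>k\<close> because the induction starts at 2.\<close>
    have one: "1 \<in> {1..<k}" "1 \<in> {1..n}" using step.hyps step.prems by auto
    have "commutator (e k \<otimes>\<^sub>1 f 1) (e 1 \<otimes>\<^sub>1 f (Suc k)) = e k \<otimes>\<^sub>1 f (Suc k)"
      "commutator (e (Suc k) \<otimes>\<^sub>1 f 1) (e 1 \<otimes>\<^sub>1 f k) = e (Suc k) \<otimes>\<^sub>1 f k"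
      using k one by (simp_all add: commutator_rank_one linear_form_f f_e scale_fun_def fun_eq_iff)
    then have last: "e k \<otimes>\<^sub>1 f (Suc k) \<in> M" "e (Suc k) \<otimes>\<^sub>1 f k \<in> M"
      using cl[OF IH[of k 1] row[OF one(1)]] cl[OF col[OF one(1)] IH[of 1 k]] one by auto
    consider "i \<in> {1..k}" "j \<in> {1..k}" | "i \<in> {1..<k}" "j = Suc k"
      | "i = Suc k" "j \<in> {1..<k}" | "i = k" "j = Suc k" | "i = Suc k" "j = k"
      using step.prems by fastforce
    then show ?case
    proof cases
      case 1
      then show ?thesis using IH \<open>i \<noteq> j\<close> by simp
    next
      case 2
      then show ?thesis using row by simp
    next
      case 3
      then show ?thesis using col by simp
    qed (simp_all only: last)
  qed
qed

text \<open>One inclusion is minimality of the hull, as \<open>sl\<close> is a subalgebra containing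
  the generators. For the other, the hull is itself a subalgebra, so it contains the off-diagonal
  matrix units.\<close>

lemma lie_generated_gen:
  assumes two: "(2 :: 'a) \<noteq> 0" and n: "n \<ge> 2"
  shows "endo.lie_generated (gen ` {1..n}) = sl"
proof
  show "endo.lie_generated (gen ` {1..n}) \<subseteq> sl"
    unfolding endo.lie_generated_def
    by (rule hull_minimal) (use gen_in_sl[OF n] lie_subalgebra_sl in auto)
  have "endo.lie_subalgebra (endo.lie_generated (gen ` {1..n}))"
    using gen_in_endomorphisms[OF n] by (intro endo.lie_subalgebra_lie_generated) auto
  moreover from this have "e i \<otimes>\<^sub>1 f j \<in> endo.lie_generated (gen ` {1..n})"
    if "i \<in> {1..n}" "j \<in> {1..n}" "i \<noteq> j" for i j
    using that n
    by (intro matrix_units_in_lie_subalgebra[OF two, where k = n])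
      (auto simp: endo.lie_generated_def intro: hull_inc)
  ultimately show "sl \<subseteq> endo.lie_generated (gen ` {1..n})"
    by (rule sl_subset_lie_subalgebra)
qed

end

theorem theorem6p11:
  fixes e :: "nat \<Rightarrow> 'a::alg_closed_field ^ 'n"
    and f :: "nat \<Rightarrow> 'a ^ 'n \<Rightarrow> 'a"
    and n :: nat
  assumes "CARD('n) = n" and "n \<ge> 2"
    and "CHAR('a) \<noteq> 2"
    and "is_basis n e" and "is_dual_basis n e f"
  shows "endo.realizes n (Gamma_A n) (\<lambda>i. x_vec e i \<otimes>\<^sub>1 h_form f i) \<and>
    endo.lie_generated ((\<lambda>i. x_vec e i \<otimes>\<^sub>1 h_form f i) ` {1..n}) = sl"
proof -
  interpret dual_bases e f n
    using assms by unfold_locales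
  note n = \<open>n \<ge> 2\<close>
  have two: "(2 :: 'a) \<noteq> 0"
  proof
    assume "(2 :: 'a) = 0"
    \<comment> \<open>The characteristic would divide the prime 2 and hence be 1 or 2; a field
      excludes 1 and the hypothesis excludes 2.\<close>
    then have "of_nat 2 = (0 :: 'a)" by simp
    then have "CHAR('a) dvd 2" by (simp only: of_nat_eq_0_iff_char_dvd)
    then show False
      using \<open>CHAR('a) \<noteq> 2\<close> CHAR_not_1' by (metis One_nat_def prime_nat_iff two_is_prime_nat)
  qed
  \<comment> \<open>Extremality is checked in \<open>sl\<close>, which is the generated Lie algebra
    by \<open>lie_generated_gen\<close>.\<close>
  have "endo.extremal_in sl (gen i)" if i: "i \<in> {1..n}" for i
    unfolding endo.extremal_in_def
  proof (intro conjI ballI exI)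
    fix T :: "'a ^ 'n \<Rightarrow> 'a ^ 'n" assume "T \<in> sl"
    then show "commutator (gen i) (commutator (gen i) T)
      = scale_fun (- 2 * h_form f i (T (x_vec e i))) (gen i)"
      by (intro commutator_rank_one_twice linear_form_h h_form_x_vec_self n i) (simp add: sl_def)
  qed (use gen_in_sl[OF n i] gen_neq_0[OF n i] in auto)
  then show ?thesis
    using lie_generated_gen[OF two n] gen_in_endomorphisms[OF n] Gamma_A_gen[OF two n]
    by (simp add: endo.realizes_def)
qed

end
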